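(* Let $\phi$ be the canonical orbital phase on $S_n$. The determinant vector $D_\phi(A)=(G_0(A),\dots,G_{n-1}(A))\in\mathbb{C}^n$ satisfies, for all $A\in M_n(\mathbb{C})$: (i) $G_0(A)=\det(A)$. (ii) Each mode $G_k(A)$ is multilinear in the rows and in the columns of $A$. (iii) For $k\neq 0$, $G_k(A)$ is not alternating in general. (iv) If $A\in M_n(\mathbb{R})$, then $G_{n-k}(A)=\overline{G_k(A)}$ for all $k$ (indices modulo $n$). (v) $\frac1n\|D_\phi(A)\|_2^2=\sum_{r=0}^{n-1}|\Lambda_r(A)|^2$ (orbital Parseval identity). (vi) Jacobi and Laplace-type formulas hold mode by mode via the modal cofactors. Namely, for every $k$: if $A(t)=(a_{ij}(t))$ is a differentiable family of matrices, then $$\frac{d}{dt}G_k(A(t))=\sum_{i,j=1}^n C^{(k)}_{ij}(A(t))\,\dot a_{ij}(t);$$ and for each fixed row $i$, $G_k(A)=\sum_{j=1}^n a_{ij}\,C^{(k)}_{ij}(A)$, and for each fixed column $j$, $G_k(A)=\sum_{i=1}^n a_{ij}\,C^{(k)}_{ij}(A)$. (vii) The classical spectrum of $A$ is recovered not from the crude modes $G_k(A)$ of total order $n$, but from the hierarchy of fundamental modes $G_0^{(r)}(A[I,I])$ of the principal minors of orders $r=1,\dots,n$, through $$\det(\lambda I_n-A)=\lambda^n+\sum_{r=1}^n(-1)^r\Big(\sum_{I\subset\{1,\dots,n\},\,|I|=r}G_0^{(r)}(A[I,I])\Big)\lambda^{n-r}.$$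
   Context: Let $\omega=e^{2\pi i/n}$, let $S_n$ be the symmetric group on $\{1,\dots,n\}$ with composition $(\sigma\circ\tau)(i)=\sigma(\tau(i))$, let $\varepsilon(\sigma)$ be the sign of $\sigma$, and let $\rho=(1\,2\,\cdots\,n)$ be the cycle $\rho(i)=i+1$ for $i<n$, $\rho(n)=1$. Each orbit $\{\sigma\circ\rho^r: r\in\mathbb{Z}/n\mathbb{Z}\}$ contains exactly one permutation $\sigma^*$ with $\sigma^*(1)=1$. The canonical orbital phase $\phi:S_n\to\mathbb{Z}/n\mathbb{Z}$ is the unique function such that $\phi(\sigma^*\circ\rho^r)=r$ for every $\sigma^*\in S_n$ with $\sigma^*(1)=1$ and every $r\in\mathbb{Z}/n\mathbb{Z}$. For $A=(a_{ij})\in M_n(\mathbb{C})$ put $m_\sigma(A)=\varepsilon(\sigma)\prod_{i=1}^n a_{i,\sigma(i)}$; $\Lambda_r(A)=\sum_{\sigma:\phi(\sigma)=r}m_\sigma(A)$ for $r=0,\dots,n-1$ (orbital sums); $G_k(A)=\sum_{r=0}^{n-1}\Lambda_r(A)\omega^{kr}$ for $k=0,\dots,n-1$ (modes; the "crude modes of total order $n$"), with $k$ read modulo $n$; $\|\cdot\|_2$ is the Euclidean norm on $\mathbb{C}^n$. The $k$-modal cofactor is $C^{(k)}_{ij}(A)=\sum_{\sigma\in S_n,\ \sigma(i)=j}\varepsilon(\sigma)\,\omega^{k\phi(\sigma)}\prod_{\ell\ne i}a_{\ell,\sigma(\ell)}$. For $I=\{i_1<\dots<i_r\}\subset\{1,\dots,n\}$,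 $A[I,I]=(a_{i_\alpha,i_\beta})_{1\le\alpha,\beta\le r}$ is the principal $r\times r$ subblock, and $G_0^{(r)}(A[I,I])$ (the fundamental mode) denotes the zeroth mode of the $r\times r$ matrix $A[I,I]$, obtained by the same construction with $n$ replaced by $r$ (group $S_r$, cycle $(1\,2\cdots r)$, its canonical phase, and $e^{2\pi i/r}$). *)

theory Defs
  imports
    Complex_Main
    "HOL-Analysis.L2_Norm"
    "Jordan_Normal_Form.Determinant"
    "Jordan_Normal_Form.Spectral_Radius"
    "Jordan_Normal_Form.DL_Submatrix"
begin

text \<open>Rows, columns and permuted points are indexed by \<open>0, \<dots>, n - 1\<close>, as in the matrix library;
  the normalisation \<open>\<sigma>(1) = 1\<close> of an orbit representative thus becomes \<open>\<sigma> 0 = 0\<close>.\<close>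

definition cycle_shift :: "nat \<Rightarrow> nat \<Rightarrow> nat" where
  "cycle_shift n i = (if i < n then Suc i mod n else i)"

text \<open>Elements of \<open>\<int>/n\<int>\<close> are represented by their residues in \<open>{0..<n}\<close>.\<close>

definition orbital_phase :: "nat \<Rightarrow> (nat \<Rightarrow> nat) \<Rightarrow> nat" where
  "orbital_phase n \<sigma> =
     (THE r. r < n \<and> (\<exists>\<tau>. \<tau> permutes {0..<n} \<and> \<tau> 0 = 0 \<and> \<sigma> = \<tau> \<circ> (cycle_shift n ^^ r)))"

definition root_of_unity :: "nat \<Rightarrow> complex" where
  "root_of_unity n = exp (2 * of_real pi * \<i> / of_nat n)"

definition signed_monomial :: "nat \<Rightarrow> (nat \<Rightarrow> nat) \<Rightarrow> complex mat \<Rightarrow> complex" where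
  "signed_monomial n \<sigma> A = signof \<sigma> * (\<Prod>i = 0..<n. A $$ (i, \<sigma> i))"

definition orbital_sum :: "nat \<Rightarrow> nat \<Rightarrow> complex mat \<Rightarrow> complex" where
  "orbital_sum n r A =
     (\<Sum>\<sigma> \<in> {\<sigma>. \<sigma> permutes {0..<n} \<and> orbital_phase n \<sigma> = r}. signed_monomial n \<sigma> A)"

text \<open>The index \<open>k\<close> is an integer: since \<open>root_of_unity n\<close> is an \<open>n\<close>-th root of unity, the value
  depends on \<open>k\<close> modulo \<open>n\<close> only.\<close>

definition mode :: "nat \<Rightarrow> int \<Rightarrow> complex mat \<Rightarrow> complex" where
  "mode n k A = (\<Sum>r = 0..<n. orbital_sum n r A * root_of_unity n powi (k * int r))"

definition determinant_vector :: "nat \<Rightarrow> complex mat \<Rightarrow> complex vec" where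
  "determinant_vector n A = vec n (\<lambda>k. mode n (int k) A)"

definition modal_cofactor :: "nat \<Rightarrow> int \<Rightarrow> complex mat \<Rightarrow> nat \<Rightarrow> nat \<Rightarrow> complex" where
  "modal_cofactor n k A i j =
     (\<Sum>\<sigma> \<in> {\<sigma>. \<sigma> permutes {0..<n} \<and> \<sigma> i = j}.
        signof \<sigma> * root_of_unity n powi (k * int (orbital_phase n \<sigma>)) *
        (\<Prod>l \<in> {0..<n} - {i}. A $$ (l, \<sigma> l)))"

text \<open>Row counterpart of the library's \<^const>\<open>replace_col\<close>.\<close>

definition replace_row :: "complex mat \<Rightarrow> complex vec \<Rightarrow> nat \<Rightarrow> complex mat" where
  "replace_row A v k =
     mat (dim_row A) (dim_col A) (\<lambda>(i, j). if i = k then v $ j else A $$ (i, j))"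

definition row_multilinear :: "nat \<Rightarrow> (complex mat \<Rightarrow> complex) \<Rightarrow> bool" where
  "row_multilinear n F \<longleftrightarrow>
     (\<forall>A \<in> carrier_mat n n. \<forall>i < n. \<forall>u \<in> carrier_vec n. \<forall>v \<in> carrier_vec n. \<forall>a b.
        F (replace_row A (a \<cdot>\<^sub>v u + b \<cdot>\<^sub>v v) i) =
        a * F (replace_row A u i) + b * F (replace_row A v i))"

definition col_multilinear :: "nat \<Rightarrow> (complex mat \<Rightarrow> complex) \<Rightarrow> bool" where
  "col_multilinear n F \<longleftrightarrow>
     (\<forall>A \<in> carrier_mat n n. \<forall>j < n. \<forall>u \<in> carrier_vec n. \<forall>v \<in> carrier_vec n. \<forall>a b.
        F (replace_col A (a \<cdot>\<^sub>v u + b \<cdot>\<^sub>v v) j) =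
        a * F (replace_col A u j) + b * F (replace_col A v j))"

definition row_alternating :: "nat \<Rightarrow> (complex mat \<Rightarrow> complex) \<Rightarrow> bool" where
  "row_alternating n F \<longleftrightarrow>
     (\<forall>A \<in> carrier_mat n n. \<forall>p < n. \<forall>q < n. p \<noteq> q \<longrightarrow> row A p = row A q \<longrightarrow> F A = 0)"

definition col_alternating :: "nat \<Rightarrow> (complex mat \<Rightarrow> complex) \<Rightarrow> bool" where
  "col_alternating n F \<longleftrightarrow>
     (\<forall>A \<in> carrier_mat n n. \<forall>p < n. \<forall>q < n. p \<noteq> q \<longrightarrow> col A p = col A q \<longrightarrow> F A = 0)"

text \<open>The description in \<^const>\<open>orbital_phase\<close> is proper: every permutation lies in the orbit of
  exactly one representative, with exactly one exponent modulo \<open>n\<close>.\<close>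

lemma cycle_shift_funpow:
  assumes "i < n"
  shows "(cycle_shift n ^^ r) i = (i + r) mod n"
proof (induction r)
  case 0
  then show ?case using assms by simp
next
  case (Suc r)
  have "(i + r) mod n < n" using assms by simp
  then show ?case using Suc by (simp add: cycle_shift_def mod_Suc_eq)
qed

lemma cycle_shift_funpow_outside:
  assumes "\<not> i < n"
  shows "(cycle_shift n ^^ r) i = i"
  using assms by (induction r) (simp_all add: cycle_shift_def)

lemma cycle_shift_funpow_multiple: "(cycle_shift n ^^ (n * m)) = id"
proof
  fix i show "(cycle_shift n ^^ (n * m)) i = id i"
    by (cases "i < n") (simp_all add: cycle_shift_funpow cycle_shift_funpow_outside)
qed

lemma cycle_shift_permutes: "cycle_shift n permutes {0..<n}"
proof (rule bij_imp_permutes)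
  have inj: "inj_on (cycle_shift n) {0..<n}"
    by (auto simp: inj_on_def cycle_shift_def mod_Suc split: if_splits)
  moreover have "cycle_shift n ` {0..<n} \<subseteq> {0..<n}"
    by (auto simp: cycle_shift_def)
  ultimately show "bij_betw (cycle_shift n) {0..<n} {0..<n}"
    by (simp add: bij_betw_def endo_inj_surj)
qed (simp add: cycle_shift_def)

lemma cycle_shift_funpow_permutes: "(cycle_shift n ^^ r) permutes {0..<n}"
proof (induction r)
  case (Suc r)
  then show ?case
    using permutes_compose[OF Suc.IH cycle_shift_permutes] by (simp add: comp_def)
qed (simp add: permutes_id[unfolded id_def] id_def)

lemma orbital_decomposition_exists:
  assumes n: "0 < n" and \<sigma>: "\<sigma> permutes {0..<n}"
  shows "\<exists>r < n. \<exists>\<tau>. \<tau> permutes {0..<n} \<and> \<tau> 0 = 0 \<and> \<sigma> = \<tau> \<circ> (cycle_shift n ^^ r)"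
proof -
  obtain j where j: "j < n" "\<sigma> j = 0"
    using permutes_image[OF \<sigma>] n by (metis atLeastLessThan_iff imageE zero_le)
  define \<tau> where "\<tau> = \<sigma> \<circ> (cycle_shift n ^^ j)"
  define r where "r = (n - j) mod n"
  have "n dvd j + r"
    using j unfolding r_def by (cases "j = 0") auto
  then obtain m where m: "j + r = n * m" by (auto simp: dvd_def)
  have "\<tau> \<circ> (cycle_shift n ^^ r) = \<sigma>"
    unfolding \<tau>_def comp_assoc funpow_add[symmetric] m cycle_shift_funpow_multiple by simp
  moreover have "\<tau> permutes {0..<n}"
    unfolding \<tau>_def by (rule permutes_compose[OF cycle_shift_funpow_permutes \<sigma>])
  moreover have "\<tau> 0 = 0"
    unfolding \<tau>_def using j n by (simp add: cycle_shift_funpow)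
  moreover have "r < n" unfolding r_def using n by simp
  ultimately show ?thesis by metis
qed

lemma orbital_decomposition_unique:
  assumes r: "r < n" and \<tau>: "\<tau> permutes {0..<n}" "\<tau> 0 = 0"
    and r': "r' < n" and \<tau>': "\<tau>' permutes {0..<n}" "\<tau>' 0 = 0"
    and eq: "\<tau> \<circ> (cycle_shift n ^^ r) = \<tau>' \<circ> (cycle_shift n ^^ r')"
  shows "r = r'"
proof -
  define j where "j = (n - r) mod n"
  have j: "j < n" "(j + r) mod n = 0"
    using r unfolding j_def by (auto simp: mod_add_left_eq)
  have "\<tau>' ((cycle_shift n ^^ r') j) = \<tau> ((cycle_shift n ^^ r) j)"
    using eq by (metis comp_apply)
  also have "\<dots> = \<tau>' 0" using j \<tau> \<tau>' by (simp add: cycle_shift_funpow)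
  finally have "(j + r') mod n = 0"
    using permutes_inj[OF \<tau>'(1)] j(1) by (simp add: cycle_shift_funpow inj_eq)
  then have "(j + r) mod n = (j + r') mod n" using j by simp
  then have "int n dvd (int j + int r) - (int j + int r')"
    by (metis mod_eq_dvd_iff of_nat_add of_nat_mod)
  then have "int r mod int n = int r' mod int n"
    by (simp add: mod_eq_dvd_iff)
  then show ?thesis using r r' by simp
qed

lemma orbital_phase_comp:
  assumes "r < n" and "\<tau> permutes {0..<n}" "\<tau> 0 = 0"
  shows "orbital_phase n (\<tau> \<circ> (cycle_shift n ^^ r)) = r"
  unfolding orbital_phase_def
proof (rule the_equality)
  show "r < n \<and> (\<exists>\<tau>'. \<tau>' permutes {0..<n} \<and> \<tau>' 0 = 0 \<and>
      \<tau> \<circ> (cycle_shift n ^^ r) = \<tau>' \<circ> (cycle_shift n ^^ r))"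
    using assms by blast
next
  fix r' assume "r' < n \<and> (\<exists>\<tau>'. \<tau>' permutes {0..<n} \<and> \<tau>' 0 = 0 \<and>
      \<tau> \<circ> (cycle_shift n ^^ r) = \<tau>' \<circ> (cycle_shift n ^^ r'))"
  then show "r' = r"
    using orbital_decomposition_unique[OF assms] by blast
qed

end

theory Submission
  imports Defs
begin

text \<open>Grouping permutations by their phase and then weighting the groups by powers of
  \<open>\<omega> = exp (2\<pi>\<i>/n)\<close> is the same as weighting each term of the Leibniz expansion by
  \<open>\<omega> powi (k \<phi>)\<close>, with \<open>\<phi>\<close> the phase of its permutation (\<open>mode_eq_sum\<close>). All properties of the modes are
  properties of this weighted Leibniz sum.

  The weights depend on the permutation only, so whatever in the theory of determinants does not
  use the multiplicativity of the sign survives. Sorting the permutations by the column that they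
  assign to a fixed row, or by the row that they send to a fixed column, gives the Laplace
  expansions along the modal cofactors. Multilinearity follows from these, since a cofactor
  ignores the entries in its own row and column; Jacobi's formula is the product rule applied to
  each monomial. The trivial weight \<open>k = 0\<close> gives the determinant. Complex conjugation inverts the
  weights, and it fixes the monomials of a real matrix. The mode vector is the discrete Fourier
  transform of the orbital sums, whence Parseval's identity.

  Alternation, by contrast, needs permutations that differ by a transposition to carry equal weights.
  The matrix consisting of a \<open>2 \<times> 2\<close> block of ones and an identity block has two equal rows and two
  equal columns, and just two nonzero monomials, of phases \<open>0\<close> and \<open>n - 1\<close>. Its mode is
  \<open>1 - \<omega> powi (k (n - 1))\<close>, which is nonzero unless \<open>n\<close> divides \<open>k\<close>.

  The spectrum comes from the principal minors through the expansion of \<open>det (\<mu> 1 - A)\<close>: choosing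
  in each factor of a Leibniz monomial either the entry of \<open>-A\<close> or that of \<open>\<mu> 1\<close>, the latter choice
  forces a fixed point, so the set \<open>I\<close> of the former choices carries a permutation of \<open>I\<close>, and the
  terms with a given \<open>I\<close> add up to \<open>(- 1) ^ card I * \<mu> ^ (n - card I)\<close> times a principal minor
  (\<open>det_smult_one_minus_eq_sum_principal_minors\<close>). The modes of order \<open>n\<close> cannot replace the
  minors: all of them vanish on a matrix with a zero column, whatever its eigenvalues are.\<close>

section \<open>Roots of unity\<close>

lemma root_of_unity_eq_cis: "root_of_unity n = cis (2 * pi / real n)"
  by (simp add: root_of_unity_def cis_conv_exp mult_ac)

lemma root_of_unity_nonzero [simp]: "root_of_unity n \<noteq> 0"
  by (simp add: root_of_unity_eq_cis)

lemma norm_root_of_unity [simp]: "cmod (root_of_unity n) = 1"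
  by (simp add: root_of_unity_eq_cis)

text \<open>That \<open>\<omega>\<close> has exact order \<open>n\<close> is the injectivity of \<open>r \<mapsto> cis (2\<pi>r/n)\<close> on residues, applied after the
  exponent has been reduced modulo \<open>n\<close>.\<close>

lemma root_of_unity_powi_eq_1_iff:
  assumes "0 < n"
  shows "root_of_unity n powi m = 1 \<longleftrightarrow> int n dvd m"
proof -
  let ?w = "root_of_unity n"
  define r where "r = nat (m mod int n)"
  have r: "r < n" "int r = m mod int n"
    using assms by (auto simp: r_def nat_less_iff)
  have pow: "?w ^ j = cis (2 * pi * real j / real n)" for j
    by (simp add: root_of_unity_eq_cis DeMoivre mult_ac)
  have "?w powi int n = 1"
    using assms by (simp add: pow)
  then have "?w powi (int n * (m div int n)) = 1"
    by (simp add: power_int_mult)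
  then have "?w powi (int n * (m div int n) + m mod int n) = ?w ^ r"
    by (simp add: power_int_add flip: r(2))
  then have "?w powi m = ?w ^ r"
    by simp
  also have "\<dots> = 1 \<longleftrightarrow> r = 0"
    using inj_onD[OF bij_betw_imp_inj_on[OF bij_betw_roots_unity[OF assms]], of r 0] r(1) assms
    by (auto simp: pow)
  also have "\<dots> \<longleftrightarrow> int n dvd m"
    using r(2) by (auto simp: dvd_eq_mod_eq_0)
  finally show ?thesis .
qed

lemma cnj_root_of_unity: "cnj (root_of_unity n) = inverse (root_of_unity n)"
  using complex_norm_square[of "root_of_unity n"] by (intro inverse_unique[symmetric]) simp

text \<open>Orthogonality of the characters of \<open>\<int>/n\<close>: with \<open>x = \<omega> powi m\<close>, the geometric sum satisfies
  \<open>(1 - x) (\<Sum>k<n. x ^ k) = 1 - x ^ n = 0\<close>.\<close>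

lemma sum_root_of_unity_powi:
  assumes "0 < n"
  shows "(\<Sum>k = 0..<n. root_of_unity n powi (int k * m)) = (if int n dvd m then of_nat n else 0)"
proof -
  let ?x = "root_of_unity n powi m"
  have powers: "root_of_unity n powi (int k * m) = ?x ^ k" for k
    by (metis mult.commute power_int_mult power_int_of_nat)
  have "root_of_unity n powi (int n * m) = 1"
    using assms by (simp add: root_of_unity_powi_eq_1_iff)
  then have "(1 - ?x) * (\<Sum>k = 0..<n. ?x ^ k) = 0"
    by (simp add: one_diff_power_eq[symmetric] powers atLeast0LessThan)
  then show ?thesis
    using root_of_unity_powi_eq_1_iff[OF assms, of m] by (auto simp: powers)
qed

text \<open>Expanding each squared modulus as a double sum over \<open>r\<close> and \<open>s\<close> and summing over \<open>k\<close> first,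
  orthogonality leaves the diagonal terms \<open>r = s\<close>.\<close>

lemma fourier_parseval:
  assumes "0 < n"
  shows "(\<Sum>k = 0..<n. (cmod (\<Sum>r = 0..<n. c r * root_of_unity n powi (int k * int r)))\<^sup>2)
    = real n * (\<Sum>r = 0..<n. (cmod (c r))\<^sup>2)"
proof -
  let ?w = "root_of_unity n"
  have "complex_of_real (\<Sum>k = 0..<n. (cmod (\<Sum>r = 0..<n. c r * ?w powi (int k * int r)))\<^sup>2)
    = (\<Sum>k = 0..<n. \<Sum>r = 0..<n. \<Sum>s = 0..<n.
        c r * cnj (c s) * ?w powi (int k * (int r - int s)))"
    unfolding of_real_sum complex_norm_square cnj_sum sum_product
    by (intro sum.cong refl)
      (simp add: cnj_root_of_unity power_int_inverse right_diff_distrib power_int_diff field_simps)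
  also have "\<dots> = (\<Sum>r = 0..<n. \<Sum>s = 0..<n. c r * cnj (c s) *
        (\<Sum>k = 0..<n. ?w powi (int k * (int r - int s))))"
    unfolding sum_distrib_left by (subst sum.swap, rule sum.cong[OF refl], rule sum.swap)
  also have "\<dots> = (\<Sum>r = 0..<n. \<Sum>s = 0..<n. if s = r then of_nat n * (c r * cnj (c r)) else 0)"
  proof (intro sum.cong refl)
    fix r s assume "r \<in> {0..<n}" "s \<in> {0..<n}"
    then have "int n dvd int r - int s \<longleftrightarrow> s = r"
      by (auto simp: mod_eq_dvd_iff[symmetric])
    then show "c r * cnj (c s) * (\<Sum>k = 0..<n. ?w powi (int k * (int r - int s)))
        = (if s = r then of_nat n * (c r * cnj (c r)) else 0)"
      by (simp add: sum_root_of_unity_powi[OF assms])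
  qed
  also have "\<dots> = complex_of_real (real n * (\<Sum>r = 0..<n. (cmod (c r))\<^sup>2))"
    by (simp add: complex_norm_square[symmetric] sum_distrib_left)
  finally show ?thesis
    using of_real_eq_iff by blast
qed

section \<open>Modes as character sums over the symmetric group\<close>

lemma orbital_phase_less:
  assumes "0 < n" "\<sigma> permutes {0..<n}"
  shows "orbital_phase n \<sigma> < n"
  using orbital_decomposition_exists[OF assms] orbital_phase_comp by metis

text \<open>The phase is visible on the preimage \<open>j\<close> of \<open>0\<close> alone: in \<open>\<sigma> = \<tau> \<circ> \<rho>\<^sup>r\<close> with \<open>\<tau> 0 = 0\<close>, the shift
  by \<open>r\<close> must carry \<open>j\<close> to \<open>0\<close>. The outer \<open>mod\<close> covers \<open>j = 0\<close>.\<close>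

lemma orbital_phase_eq:
  assumes "0 < n" "\<sigma> permutes {0..<n}" "j < n" "\<sigma> j = 0"
  shows "orbital_phase n \<sigma> = (n - j) mod n"
proof -
  obtain r \<tau> where r: "r < n" "\<tau> permutes {0..<n}" "\<tau> 0 = 0" "\<sigma> = \<tau> \<circ> (cycle_shift n ^^ r)"
    using orbital_decomposition_exists[OF assms(1,2)] by blast
  have "\<tau> ((j + r) mod n) = \<tau> 0"
    using assms r by (simp add: cycle_shift_funpow)
  then have "(j + r) mod n = 0"
    using permutes_inj[OF r(2)] by (simp add: inj_eq)
  then have "r = (n - j) mod n"
    using r(1) assms(3) by (cases "j + r < n") (auto simp: le_mod_geq)
  then show ?thesis
    using r orbital_phase_comp by simp
qed

lemma mode_eq_sum:
  assumes "0 < n"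
  shows "mode n k A = (\<Sum>\<sigma> | \<sigma> permutes {0..<n}.
    root_of_unity n powi (k * int (orbital_phase n \<sigma>)) * signed_monomial n \<sigma> A)"
proof -
  let ?P = "{\<sigma>. \<sigma> permutes {0..<n}}"
  let ?h = "\<lambda>\<sigma>. root_of_unity n powi (k * int (orbital_phase n \<sigma>)) * signed_monomial n \<sigma> A"
  have "mode n k A = (\<Sum>r = 0..<n. sum ?h {\<sigma> \<in> ?P. orbital_phase n \<sigma> = r})"
    unfolding mode_def orbital_sum_def sum_distrib_right by (intro sum.cong) auto
  also have "\<dots> = sum ?h ?P"
    by (rule sum.group) (auto simp: finite_permutations orbital_phase_less assms)
  finally show ?thesis .
qed

lemma mode_0_eq_det:
  assumes "0 < n" "A \<in> carrier_mat n n"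
  shows "mode n 0 A = det A"
  by (simp add: mode_eq_sum[OF assms(1)] det_def'[OF assms(2)] signed_monomial_def)

text \<open>Replacing \<open>k\<close> by \<open>n - k\<close> inverts every weight, because \<open>\<omega>\<^sup>n = 1\<close>, and on the unit circle inversion
  is conjugation.\<close>

lemma mode_reflect:
  assumes "0 < n" and real: "\<forall>i < n. \<forall>j < n. A $$ (i, j) \<in> \<real>"
  shows "mode n (int n - k) A = cnj (mode n k A)"
proof -
  let ?w = "root_of_unity n"
  have "?w powi ((int n - k) * int r) = cnj (?w powi (k * int r))" for r
  proof -
    have "?w powi (int n * int r) = 1"
      by (simp add: root_of_unity_powi_eq_1_iff[OF assms(1)])
    then show ?thesis
      by (simp add: cnj_root_of_unity power_int_inverse left_diff_distrib power_int_diff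
          divide_inverse)
  qed
  moreover have "cnj (signed_monomial n \<sigma> A) = signed_monomial n \<sigma> A" if "\<sigma> permutes {0..<n}" for \<sigma>
  proof -
    have "cnj (A $$ (i, \<sigma> i)) = A $$ (i, \<sigma> i)" if "i \<in> {0..<n}" for i
      using real \<open>\<sigma> permutes {0..<n}\<close> that permutes_in_image[of \<sigma> "{0..<n}" i]
      by (simp add: Reals_cnj_iff)
    then show ?thesis
      by (simp add: signed_monomial_def)
  qed
  ultimately show ?thesis
    by (simp add: mode_eq_sum[OF assms(1)])
qed

lemma parseval_determinant_vector:
  assumes "0 < n"
  shows "1 / real n * (L2_set (\<lambda>k. cmod (determinant_vector n A $ k)) {0..<n})\<^sup>2
    = (\<Sum>r = 0..<n. (cmod (orbital_sum n r A))\<^sup>2)"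
proof -
  have "(L2_set (\<lambda>k. cmod (determinant_vector n A $ k)) {0..<n})\<^sup>2
      = (\<Sum>k = 0..<n. (cmod (mode n (int k) A))\<^sup>2)"
    by (simp add: L2_set_def sum_nonneg determinant_vector_def)
  also have "\<dots> = real n * (\<Sum>r = 0..<n. (cmod (orbital_sum n r A))\<^sup>2)"
    unfolding mode_def by (rule fourier_parseval[OF assms])
  finally show ?thesis
    using assms by simp
qed

section \<open>Modal cofactors\<close>

text \<open>Here the \<open>i\<close>-th row is replaced by an arbitrary \<open>g\<close>: the entries of \<open>A\<close> itself give the Laplace
  expansion, and their derivatives give the \<open>i\<close>-th part of Jacobi's formula.\<close>

lemma sum_modal_cofactor_row:
  assumes "i < n"
  shows "(\<Sum>j = 0..<n. g j * modal_cofactor n k A i j)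
    = (\<Sum>\<sigma> | \<sigma> permutes {0..<n}. signof \<sigma> * root_of_unity n powi (k * int (orbital_phase n \<sigma>)) *
        (g (\<sigma> i) * (\<Prod>l \<in> {0..<n} - {i}. A $$ (l, \<sigma> l))))"
    (is "_ = sum ?h ?P")
proof -
  have "(\<Sum>j = 0..<n. g j * modal_cofactor n k A i j)
      = (\<Sum>j = 0..<n. sum ?h {\<sigma> \<in> ?P. \<sigma> i = j})"
    unfolding modal_cofactor_def sum_distrib_left by (intro sum.cong) auto
  also have "\<dots> = sum ?h ?P"
    using assms permutes_in_image[of _ "{0..<n}" i]
    by (intro sum.group) (auto simp: finite_permutations)
  finally show ?thesis .
qed

lemma mode_row_expansion:
  assumes "i < n"
  shows "mode n k A = (\<Sum>j = 0..<n. A $$ (i, j) * modal_cofactor n k A i j)"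
  unfolding sum_modal_cofactor_row[OF assms]
  using assms
  by (subst mode_eq_sum)
    (auto simp: signed_monomial_def prod.remove[of "{0..<n}" i] intro!: sum.cong)

text \<open>The same sorting of permutations as for rows, now by the preimage of \<open>j\<close>. Transposing \<open>A\<close> would
  not help, since \<open>\<sigma>\<close> and its inverse have different phases in general.\<close>

lemma mode_column_expansion:
  assumes "j < n"
  shows "mode n k A = (\<Sum>i = 0..<n. A $$ (i, j) * modal_cofactor n k A i j)"
proof -
  let ?P = "{\<sigma>. \<sigma> permutes {0..<n}}"
  let ?h = "\<lambda>\<sigma>. root_of_unity n powi (k * int (orbital_phase n \<sigma>)) * signed_monomial n \<sigma> A"
  have "A $$ (i, j) * modal_cofactor n k A i j = sum ?h {\<sigma> \<in> ?P. Hilbert_Choice.inv \<sigma> j = i}"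
    if "i \<in> {0..<n}" for i
    unfolding modal_cofactor_def sum_distrib_left
  proof (intro sum.cong)
    show "{\<sigma>. \<sigma> permutes {0..<n} \<and> \<sigma> i = j} = {\<sigma> \<in> ?P. Hilbert_Choice.inv \<sigma> j = i}"
      using permutes_inv_eq by fast
  next
    fix \<sigma> assume "\<sigma> \<in> {\<sigma> \<in> ?P. Hilbert_Choice.inv \<sigma> j = i}"
    then have "\<sigma> i = j"
      using permutes_inv_eq by fast
    then show "A $$ (i, j) * (signof \<sigma> * root_of_unity n powi (k * int (orbital_phase n \<sigma>)) *
        (\<Prod>l \<in> {0..<n} - {i}. A $$ (l, \<sigma> l))) = ?h \<sigma>"
      using that by (simp add: signed_monomial_def prod.remove[of "{0..<n}" i])
  qed
  then have "(\<Sum>i = 0..<n. A $$ (i, j) * modal_cofactor n k A i j)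
      = (\<Sum>i = 0..<n. sum ?h {\<sigma> \<in> ?P. Hilbert_Choice.inv \<sigma> j = i})"
    by simp
  also have "\<dots> = sum ?h ?P"
    using assms permutes_in_image[OF permutes_inv, of _ "{0..<n}" j]
    by (intro sum.group) (auto simp: finite_permutations)
  also have "\<dots> = mode n k A"
    using assms by (simp add: mode_eq_sum)
  finally show ?thesis ..
qed

text \<open>Column \<open>j\<close> does not enter because an injective \<open>\<sigma>\<close> with \<open>\<sigma> i = j\<close> takes the value \<open>j\<close> nowhere
  else.\<close>

lemma modal_cofactor_cong:
  assumes "i < n" "\<And>l m. l < n \<Longrightarrow> m < n \<Longrightarrow> l \<noteq> i \<Longrightarrow> m \<noteq> j \<Longrightarrow> A $$ (l, m) = B $$ (l, m)"
  shows "modal_cofactor n k A i j = modal_cofactor n k B i j"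
proof -
  have "A $$ (l, \<sigma> l) = B $$ (l, \<sigma> l)"
    if "\<sigma> permutes {0..<n}" "\<sigma> i = j" "l \<in> {0..<n} - {i}" for \<sigma> l
  proof -
    have "\<sigma> l \<noteq> j"
      using that permutes_inj[OF that(1)] by (auto dest: injD)
    moreover have "\<sigma> l < n"
      using that permutes_in_image[OF that(1), of l] by simp
    ultimately show ?thesis
      using assms that by auto
  qed
  then show ?thesis
    unfolding modal_cofactor_def by (auto intro!: sum.cong prod.cong)
qed

lemma row_multilinear_mode: "row_multilinear n (mode n k)"
  unfolding row_multilinear_def
proof (intro ballI allI impI)
  fix A u v a b i
  assume A: "(A :: complex mat) \<in> carrier_mat n n" and i: "i < n"
    and u: "(u :: complex vec) \<in> carrier_vec n" and v: "(v :: complex vec) \<in> carrier_vec n"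
  have "mode n k (replace_row A w i) = (\<Sum>j = 0..<n. w $ j * modal_cofactor n k A i j)" for w
  proof -
    have "modal_cofactor n k (replace_row A w i) i j = modal_cofactor n k A i j" for j
      using i A by (intro modal_cofactor_cong) (auto simp: replace_row_def)
    then show ?thesis
      using i A by (simp add: mode_row_expansion[OF i]) (simp add: replace_row_def)
  qed
  then show "mode n k (replace_row A (a \<cdot>\<^sub>v u + b \<cdot>\<^sub>v v) i)
      = a * mode n k (replace_row A u i) + b * mode n k (replace_row A v i)"
    using u v by (simp add: sum_distrib_left sum.distrib algebra_simps)
qed

lemma col_multilinear_mode: "col_multilinear n (mode n k)"
  unfolding col_multilinear_def
proof (intro ballI allI impI)
  fix A u v a b j
  assume A: "(A :: complex mat) \<in> carrier_mat n n" and j: "j < n"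
    and u: "(u :: complex vec) \<in> carrier_vec n" and v: "(v :: complex vec) \<in> carrier_vec n"
  have "mode n k (replace_col A w j) = (\<Sum>i = 0..<n. w $ i * modal_cofactor n k A i j)" for w
  proof -
    have "modal_cofactor n k (replace_col A w j) i j = modal_cofactor n k A i j" if "i < n" for i
      using that A by (intro modal_cofactor_cong) (auto simp: replace_col_def)
    then show ?thesis
      using j A by (simp add: mode_column_expansion[OF j]) (simp add: replace_col_def)
  qed
  then show "mode n k (replace_col A (a \<cdot>\<^sub>v u + b \<cdot>\<^sub>v v) j)
      = a * mode n k (replace_col A u j) + b * mode n k (replace_col A v j)"
    using u v by (simp add: sum_distrib_left sum.distrib algebra_simps)
qed

lemma has_vector_derivative_mode:
  fixes A :: "real \<Rightarrow> complex mat"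
  assumes "0 < n"
    and "\<And>i j. i < n \<Longrightarrow> j < n \<Longrightarrow>
      ((\<lambda>s. A s $$ (i, j)) has_vector_derivative A' i j) (at t within S)"
  shows "((\<lambda>s. mode n k (A s)) has_vector_derivative
    (\<Sum>i = 0..<n. \<Sum>j = 0..<n. modal_cofactor n k (A t) i j * A' i j)) (at t within S)"
proof -
  let ?P = "{\<sigma>. \<sigma> permutes {0..<n}}"
  define c :: "(nat \<Rightarrow> nat) \<Rightarrow> complex" where
    "c \<sigma> = signof \<sigma> * root_of_unity n powi (k * int (orbital_phase n \<sigma>))" for \<sigma>
  have monomial: "((\<lambda>s. \<Prod>i = 0..<n. A s $$ (i, \<sigma> i)) has_vector_derivative
      (\<Sum>i = 0..<n. A' i (\<sigma> i) * (\<Prod>l \<in> {0..<n} - {i}. A t $$ (l, \<sigma> l)))) (at t within S)"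
    if "\<sigma> \<in> ?P" for \<sigma>
  proof -
    have "\<sigma> i < n" if "i \<in> {0..<n}" for i
      using that \<open>\<sigma> \<in> ?P\<close> permutes_in_image[of \<sigma> "{0..<n}" i] by simp
    then have "((\<lambda>s. \<Prod>i = 0..<n. A s $$ (i, \<sigma> i)) has_derivative
        (\<lambda>y. \<Sum>i = 0..<n. (y *\<^sub>R A' i (\<sigma> i)) * (\<Prod>l \<in> {0..<n} - {i}. A t $$ (l, \<sigma> l))))
        (at t within S)"
      using assms(2) by (intro has_derivative_prod) (auto simp: has_vector_derivative_def)
    then show ?thesis
      by (simp add: has_vector_derivative_def scaleR_sum_right)
  qed
  have "((\<lambda>s. \<Sum>\<sigma> \<in> ?P. c \<sigma> * (\<Prod>i = 0..<n. A s $$ (i, \<sigma> i))) has_vector_derivative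
      (\<Sum>\<sigma> \<in> ?P. c \<sigma> * (\<Sum>i = 0..<n. A' i (\<sigma> i) * (\<Prod>l \<in> {0..<n} - {i}. A t $$ (l, \<sigma> l)))))
      (at t within S)"
    by (intro has_vector_derivative_sum has_vector_derivative_mult_right monomial)
  moreover have "(\<Sum>\<sigma> \<in> ?P. c \<sigma> * (\<Prod>i = 0..<n. B $$ (i, \<sigma> i))) = mode n k B" for B
    by (simp add: mode_eq_sum[OF assms(1)] c_def signed_monomial_def mult_ac)
  moreover have "(\<Sum>\<sigma> \<in> ?P. c \<sigma> * (\<Sum>i = 0..<n. A' i (\<sigma> i) * (\<Prod>l \<in> {0..<n} - {i}. A t $$ (l, \<sigma> l))))
      = (\<Sum>i = 0..<n. \<Sum>j = 0..<n. modal_cofactor n k (A t) i j * A' i j)"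
  proof -
    have "(\<Sum>i = 0..<n. \<Sum>j = 0..<n. modal_cofactor n k (A t) i j * A' i j)
        = (\<Sum>i = 0..<n. \<Sum>\<sigma> \<in> ?P. c \<sigma> * (A' i (\<sigma> i) * (\<Prod>l \<in> {0..<n} - {i}. A t $$ (l, \<sigma> l))))"
      using sum_modal_cofactor_row[of _ n "A' _" k "A t"]
      by (simp add: c_def mult.commute[of "modal_cofactor _ _ _ _ _"])
    also have "\<dots> = (\<Sum>\<sigma> \<in> ?P. c \<sigma> *
        (\<Sum>i = 0..<n. A' i (\<sigma> i) * (\<Prod>l \<in> {0..<n} - {i}. A t $$ (l, \<sigma> l))))"
      unfolding sum_distrib_left by (rule sum.swap)
    finally show ?thesis ..
  qed
  ultimately show ?thesis
    by simp
qed

section \<open>Failure of alternation\<close>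

text \<open>A \<open>2 \<times> 2\<close> block of ones followed by an identity block, so that the first two rows agree and the
  first two columns agree.\<close>

definition doubled_identity :: "nat \<Rightarrow> complex mat" where
  "doubled_identity n = mat n n (\<lambda>(i, j). if i = j \<or> (i < 2 \<and> j < 2) then 1 else 0)"

text \<open>A permutation with nonzero monomial fixes every \<open>i \<ge> 2\<close>, hence is the identity or the transposition
  \<open>(0 1)\<close>; the latter sends \<open>1\<close> to \<open>0\<close> and thus has phase \<open>n - 1\<close>.\<close>

lemma mode_doubled_identity:
  assumes "2 \<le> n"
  shows "mode n k (doubled_identity n) = 1 - root_of_unity n powi (k * (int n - 1))"
proof -
  let ?M = "doubled_identity n" and ?s = "transpose (0::nat) 1"
  have perm: "id permutes {0..<n}" "?s permutes {0..<n}"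
    using assms permutes_id permutes_swap_id[of 0 "{0..<n}" 1] by auto
  have distinct: "id \<noteq> ?s"
    by (metis id_apply transpose_apply_first zero_neq_one)
  have phase: "orbital_phase n id = 0" "orbital_phase n ?s = n - 1"
    using assms orbital_phase_eq[OF _ perm(1), of 0] orbital_phase_eq[OF _ perm(2), of 1] by auto
  have monomial: "signed_monomial n id ?M = 1" "signed_monomial n ?s ?M = - 1"
    using assms
    by (auto simp: signed_monomial_def doubled_identity_def sign_swap_id transpose_def
        intro!: prod.neutral)
  have vanish: "signed_monomial n \<sigma> ?M = 0"
    if \<sigma>: "\<sigma> permutes {0..<n}" "\<sigma> \<notin> {id, ?s}" for \<sigma>
  proof -
    have "\<not> \<sigma> permutes {0, 1}"
      using \<sigma>(2) by (simp add: permutes_doubleton_iff)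
    then obtain i where i: "i \<in> {0..<n} - {0, 1}" "\<sigma> i \<noteq> i"
      using permutes_superset[OF \<sigma>(1), of "{0, 1}"] by blast
    moreover have "\<sigma> i < n"
      using \<sigma>(1) i permutes_in_image[OF \<sigma>(1), of i] by simp
    ultimately have "?M $$ (i, \<sigma> i) = 0"
      by (auto simp: doubled_identity_def)
    then show ?thesis
      using i by (auto simp: signed_monomial_def intro!: prod_zero)
  qed
  have "mode n k ?M = (\<Sum>\<sigma> | \<sigma> permutes {0..<n}.
      root_of_unity n powi (k * int (orbital_phase n \<sigma>)) * signed_monomial n \<sigma> ?M)"
    using assms by (simp add: mode_eq_sum)
  also have "\<dots> = (\<Sum>\<sigma> \<in> {id, ?s}.
      root_of_unity n powi (k * int (orbital_phase n \<sigma>)) * signed_monomial n \<sigma> ?M)"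
  proof (rule sum.mono_neutral_right)
    show "finite {\<sigma>. \<sigma> permutes {0..<n}}"
      by (simp add: finite_permutations)
    show "{id, ?s} \<subseteq> {\<sigma>. \<sigma> permutes {0..<n}}"
      using perm by simp
  qed (auto simp: vanish)
  also have "\<dots> = 1 - root_of_unity n powi (k * int (n - 1))"
    using distinct by (simp add: phase monomial del: One_nat_def)
  finally show ?thesis
    using assms by (simp add: of_nat_diff)
qed

lemma mode_doubled_identity_nonzero:
  assumes "2 \<le> n" "k mod int n \<noteq> 0"
  shows "mode n k (doubled_identity n) \<noteq> 0"
proof
  assume "mode n k (doubled_identity n) = 0"
  then have "int n dvd k * (int n - 1)"
    using assms by (simp add: mode_doubled_identity root_of_unity_powi_eq_1_iff[symmetric])
  \<comment> \<open>The difference is \<open>k\<close>: modulo \<open>n\<close>, the factor \<open>n - 1\<close> is the unit \<open>-1\<close>.\<close>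
  then have "int n dvd k * int n - k * (int n - 1)"
    by (intro dvd_diff) auto
  then show False
    using assms by (simp add: algebra_simps dvd_eq_mod_eq_0)
qed

lemma not_alternating_mode:
  assumes "2 \<le> n" "k mod int n \<noteq> 0"
  shows "\<not> row_alternating n (mode n k)" "\<not> col_alternating n (mode n k)"
proof -
  let ?M = "doubled_identity n"
  have M: "?M \<in> carrier_mat n n" and less: "0 < n" "1 < n" and neq: "0 \<noteq> (1::nat)"
    using assms by (auto simp: doubled_identity_def)
  have "row ?M 0 = row ?M 1" "col ?M 0 = col ?M 1"
    using assms by (auto simp: doubled_identity_def intro!: eq_vecI)
  then show "\<not> row_alternating n (mode n k)" "\<not> col_alternating n (mode n k)"
    using mode_doubled_identity_nonzero[OF assms] M less neq
    unfolding row_alternating_def col_alternating_def by blast+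
qed

section \<open>Principal minors and the spectrum\<close>

lemma bij_betw_pick:
  assumes "finite I"
  shows "bij_betw (pick I) {0..<card I} I"
proof -
  have "inj_on (pick I) {0..<card I}"
    by (rule inj_onI) (metis atLeastLessThan_iff card_pick)
  moreover have "pick I ` {0..<card I} \<subseteq> I"
    by (auto simp: pick_in_set)
  ultimately show ?thesis
    using assms by (simp add: bij_betw_def card_image card_subset_eq)
qed

lemma bij_betw_map_permutation:
  assumes "bij_betw f A B"
  shows "bij_betw (map_permutation A f) {p. p permutes A} {p. p permutes B}"
proof -
  have "map_permutation A f = (\<lambda>p x. if x \<in> B then f (p (inv_into A f x)) else x)"
    using assms by (auto simp: map_permutation_def restrict_id_def bij_betw_def fun_eq_iff)
  then show ?thesis
    using bij_betw_permutations[OF assms] by simp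
qed

lemma principal_submatrix_carrier:
  assumes "A \<in> carrier_mat n n" "I \<subseteq> {0..<n}"
  shows "submatrix A I I \<in> carrier_mat (card I) (card I)"
proof -
  have "{i. i < n \<and> i \<in> I} = I"
    using assms(2) by auto
  then show ?thesis
    using assms(1) by (intro carrier_matI) (simp_all add: dim_submatrix)
qed

text \<open>The increasing enumeration of \<open>I\<close> conjugates the permutations of \<open>{0..<card I}\<close> into those of \<open>I\<close>
  without changing signs. The minor thus becomes a sum over permutations of \<open>I\<close> inside
  \<open>{0..<n}\<close>, which can be compared with the Leibniz expansion of the full matrix.\<close>

lemma det_principal_submatrix:
  assumes A: "A \<in> carrier_mat n n" and I: "I \<subseteq> {0..<n}"
  shows "det (submatrix A I I) = (\<Sum>p | p permutes I. signof p * (\<Prod>i \<in> I. A $$ (i, p i)))"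
proof -
  let ?R = "{0..<card I}" and ?f = "pick I"
  let ?T = "map_permutation ?R ?f"
  have fin: "finite I"
    using I finite_subset by blast
  have bij: "bij_betw ?f ?R I"
    by (rule bij_betw_pick[OF fin])
  then have inj: "inj_on ?f ?R"
    by (rule bij_betw_imp_inj_on)
  have rows: "{i. i < dim_row A \<and> i \<in> I} = I" "{i. i < dim_col A \<and> i \<in> I} = I"
    using A I by auto
  have "(\<Sum>p | p permutes I. signof p * (\<Prod>i \<in> I. A $$ (i, p i)))
      = (\<Sum>p | p permutes ?R. signof (?T p) * (\<Prod>i \<in> I. A $$ (i, ?T p i)))"
    by (rule sum.reindex_bij_betw[symmetric]) (rule bij_betw_map_permutation[OF bij])
  also have "\<dots> = (\<Sum>p | p permutes ?R. signof p * (\<Prod>i = 0..<card I. submatrix A I I $$ (i, p i)))"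
  proof (intro sum.cong refl)
    fix p assume "p \<in> {p. p permutes ?R}"
    then have p: "p permutes ?R"
      by simp
    have "(\<Prod>i \<in> I. A $$ (i, ?T p i)) = (\<Prod>i \<in> ?R. A $$ (?f i, ?T p (?f i)))"
      by (rule prod.reindex_bij_betw[OF bij, symmetric])
    also have "\<dots> = (\<Prod>i \<in> ?R. submatrix A I I $$ (i, p i))"
    proof (rule prod.cong)
      fix i assume i: "i \<in> ?R"
      then have "p i < card I"
        using permutes_in_image[OF p, of i] by simp
      then show "A $$ (?f i, ?T p (?f i)) = submatrix A I I $$ (i, p i)"
        using i by (simp add: map_permutation_apply[OF inj] submatrix_index rows)
    qed simp
    finally show "signof (?T p) * (\<Prod>i \<in> I. A $$ (i, ?T p i))
        = signof p * (\<Prod>i = 0..<card I. submatrix A I I $$ (i, p i))"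
      by (simp add: sign_map_permutation[OF inj p])
  qed
  also have "\<dots> = det (submatrix A I I)"
    by (rule det_def'[symmetric, OF principal_submatrix_carrier[OF A I]])
  finally show ?thesis ..
qed

text \<open>Multiplying out \<open>\<Prod>i. (- A $$ (i, \<sigma> i) + (if \<sigma> i = i then \<mu> else 0))\<close> over the subsets \<open>I\<close> of factors where the first summand is
  taken, a product survives only if \<open>\<sigma>\<close> fixes the complement of \<open>I\<close>, that is, if \<open>\<sigma>\<close> permutes \<open>I\<close>.\<close>

lemma det_smult_one_minus_eq_sum_principal_minors:
  fixes A :: "'a :: comm_ring_1 mat"
  assumes A: "A \<in> carrier_mat n n"
  shows "det (\<mu> \<cdot>\<^sub>m 1\<^sub>m n - A) =
    (\<Sum>I \<in> Pow {0..<n}. (- 1) ^ card I * det (submatrix A I I) * \<mu> ^ (n - card I))"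
proof -
  let ?N = "{0..<n}"
  have fixed_outside: "(\<Prod>i \<in> ?N - I. if p i = i then \<mu> else 0)
      = (if p permutes I then \<mu> ^ (n - card I) else 0)"
    if p: "p permutes ?N" and I: "I \<in> Pow ?N" for p I
  proof (cases "\<forall>i \<in> ?N - I. p i = i")
    case True
    then have "p permutes I"
      by (intro permutes_superset[OF p]) auto
    moreover have "card (?N - I) = n - card I"
      using I by (simp add: card_Diff_subset finite_subset[of I ?N])
    ultimately show ?thesis
      using True by simp
  next
    case False
    then have "\<not> p permutes I"
      by (auto simp: permutes_def)
    moreover have "(\<Prod>i \<in> ?N - I. if p i = i then \<mu> else 0) = 0"
      using False by (intro prod_zero) auto
    ultimately show ?thesis
      by simp
  qed
  have entry: "(\<mu> \<cdot>\<^sub>m 1\<^sub>m n - A) $$ (i, p i) = - A $$ (i, p i) + (if p i = i then \<mu> else 0)"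
    if "p permutes ?N" "i \<in> ?N" for p i
    using that A permutes_in_image[OF that(1), of i] by auto
  have "det (\<mu> \<cdot>\<^sub>m 1\<^sub>m n - A)
      = (\<Sum>p | p permutes ?N. signof p * (\<Prod>i \<in> ?N. - A $$ (i, p i) + (if p i = i then \<mu> else 0)))"
    using A entry by (subst det_def'[of _ n]) (auto intro!: sum.cong prod.cong)
  also have "\<dots> = (\<Sum>p | p permutes ?N. \<Sum>I \<in> Pow ?N.
      signof p * ((\<Prod>i \<in> I. - A $$ (i, p i)) * (\<Prod>i \<in> ?N - I. if p i = i then \<mu> else 0)))"
    by (simp only: prod_add[OF finite_atLeastLessThan] sum_distrib_left)
  also have "\<dots> = (\<Sum>I \<in> Pow ?N. \<Sum>p | p permutes ?N.
      signof p * ((\<Prod>i \<in> I. - A $$ (i, p i)) * (\<Prod>i \<in> ?N - I. if p i = i then \<mu> else 0)))"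
    by (rule sum.swap)
  also have "\<dots> = (\<Sum>I \<in> Pow ?N. \<Sum>p | p permutes ?N.
      if p permutes I then (- 1) ^ card I * (signof p * (\<Prod>i \<in> I. A $$ (i, p i))) * \<mu> ^ (n - card I)
      else 0)"
    by (intro sum.cong refl) (auto simp: fixed_outside prod_uminus mult_ac)
  also have "\<dots> = (\<Sum>I \<in> Pow ?N. \<Sum>p | p permutes I.
      (- 1) ^ card I * (signof p * (\<Prod>i \<in> I. A $$ (i, p i))) * \<mu> ^ (n - card I))"
  proof (rule sum.cong[OF refl])
    fix I assume "I \<in> Pow ?N"
    then have filter: "{p \<in> {p. p permutes ?N}. p permutes I} = {p. p permutes I}"
      using permutes_subset[of _ I ?N] by auto
    show "(\<Sum>p | p permutes ?N. if p permutes I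
        then (- 1) ^ card I * (signof p * (\<Prod>i \<in> I. A $$ (i, p i))) * \<mu> ^ (n - card I) else 0)
      = (\<Sum>p | p permutes I. (- 1) ^ card I * (signof p * (\<Prod>i \<in> I. A $$ (i, p i))) * \<mu> ^ (n - card I))"
      by (subst sum.inter_filter[OF finite_permutations[OF finite_atLeastLessThan], symmetric])
        (simp only: filter)
  qed
  also have "\<dots> = (\<Sum>I \<in> Pow ?N. (- 1) ^ card I * det (submatrix A I I) * \<mu> ^ (n - card I))"
    by (intro sum.cong refl)
      (simp add: det_principal_submatrix[OF A] sum_distrib_left sum_distrib_right)
  finally show ?thesis .
qed

text \<open>The empty subset contributes \<open>\<mu> ^ n\<close>. It is split off because modes of order \<open>0\<close> are not
  determinants: their sum over \<open>r < 0\<close> is empty, whereas the empty determinant is \<open>1\<close>.\<close>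

lemma det_smult_one_minus_eq_sum_fundamental_modes:
  assumes A: "A \<in> carrier_mat n n"
  shows "det (\<mu> \<cdot>\<^sub>m 1\<^sub>m n - A) = \<mu> ^ n + (\<Sum>r = 1..n. (- 1) ^ r *
    (\<Sum>I \<in> {I. I \<subseteq> {0..<n} \<and> card I = r}. mode r 0 (submatrix A I I)) * \<mu> ^ (n - r))"
proof -
  let ?h = "\<lambda>I. (- 1) ^ card I * det (submatrix A I I) * \<mu> ^ (n - card I)"
  have "det (\<mu> \<cdot>\<^sub>m 1\<^sub>m n - A) = sum ?h (Pow {0..<n})"
    by (rule det_smult_one_minus_eq_sum_principal_minors[OF A])
  also have "\<dots> = (\<Sum>r = 0..n. sum ?h {I \<in> Pow {0..<n}. card I = r})"
    using card_mono[of "{0..<n}"] by (intro sum.group[symmetric]) auto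
  also have "\<dots> = sum ?h {I \<in> Pow {0..<n}. card I = 0}
      + (\<Sum>r = 1..n. sum ?h {I \<in> Pow {0..<n}. card I = r})"
    by (simp add: sum.atLeast_Suc_atMost)
  also have "{I \<in> Pow {0..<n}. card I = 0} = {{}}"
    by (auto dest: finite_subset)
  also have "sum ?h {{}} = \<mu> ^ n"
    using det_principal_submatrix[OF A, of "{}"] by simp
  also have "(\<Sum>r = 1..n. sum ?h {I \<in> Pow {0..<n}. card I = r})
    = (\<Sum>r = 1..n. (- 1) ^ r *
      (\<Sum>I \<in> {I. I \<subseteq> {0..<n} \<and> card I = r}. mode r 0 (submatrix A I I)) * \<mu> ^ (n - r))"
    unfolding sum_distrib_left sum_distrib_right
    by (intro sum.cong refl) (auto simp: mode_0_eq_det principal_submatrix_carrier[OF A])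
  finally show ?thesis .
qed

text \<open>The zero matrix and the matrix unit at \<open>(1, 1)\<close> both have a zero column \<open>0\<close>, so expanding along it
  all their modes vanish; but \<open>1\<close> is an eigenvalue of the second only.\<close>

lemma modes_do_not_determine_spectrum:
  assumes "2 \<le> n"
  shows "\<exists>B \<in> carrier_mat n n. \<exists>C \<in> carrier_mat n n.
    (\<forall>k. mode n k B = mode n k C) \<and> spectrum B \<noteq> spectrum C"
proof -
  let ?B = "0\<^sub>m n n :: complex mat"
  let ?C = "mat n n (\<lambda>(i, j). if i = 1 \<and> j = 1 then 1 else 0) :: complex mat"
  have carrier: "?B \<in> carrier_mat n n" "?C \<in> carrier_mat n n"
    by auto
  have "mode n k ?B = mode n k ?C" for k
    using assms by (simp add: mode_column_expansion[of 0 n])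
  moreover have "eigenvector ?C (unit_vec n 1) 1"
    using assms by (auto simp: eigenvector_def intro!: eq_vecI)
  then have "1 \<in> spectrum ?C"
    by (auto simp: spectrum_def eigenvalue_def)
  moreover have "1 \<notin> spectrum ?B"
  proof -
    have "?B *\<^sub>v v = 0\<^sub>v n" if "v \<in> carrier_vec n" for v
      using that by (intro eq_vecI) (auto simp: scalar_prod_def)
    then show ?thesis
      by (auto simp: spectrum_def eigenvalue_def eigenvector_def)
  qed
  ultimately show ?thesis
    using carrier by metis
qed

theorem theoremA:
  fixes n :: nat
  assumes "1 \<le> n"
  shows
    "(\<forall>A \<in> carrier_mat n n. mode n 0 A = det A)
     \<and>
     (\<forall>k. row_multilinear n (mode n k) \<and> col_multilinear n (mode n k))
     \<and>
     (\<forall>k. k mod int n \<noteq> 0 \<longrightarrow>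
        \<not> row_alternating n (mode n k) \<and> \<not> col_alternating n (mode n k))
     \<and>
     (\<forall>A \<in> carrier_mat n n. (\<forall>i < n. \<forall>j < n. A $$ (i, j) \<in> \<real>) \<longrightarrow>
        (\<forall>k. mode n (int n - k) A = cnj (mode n k A)))
     \<and>
     (\<forall>A \<in> carrier_mat n n.
        1 / real n * (L2_set (\<lambda>k. cmod (determinant_vector n A $ k)) {0..<n})\<^sup>2
          = (\<Sum>r = 0..<n. (cmod (orbital_sum n r A))\<^sup>2))
     \<and>
     (\<forall>k.
        (\<forall>(A :: real \<Rightarrow> complex mat) A' S t.
           (\<forall>s \<in> S. A s \<in> carrier_mat n n) \<longrightarrow> t \<in> S \<longrightarrow>
           (\<forall>i < n. \<forall>j < n.
              ((\<lambda>s. A s $$ (i, j)) has_vector_derivative A' i j) (at t within S)) \<longrightarrow>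
           ((\<lambda>s. mode n k (A s)) has_vector_derivative
              (\<Sum>i = 0..<n. \<Sum>j = 0..<n. modal_cofactor n k (A t) i j * A' i j)) (at t within S))
        \<and> (\<forall>A \<in> carrier_mat n n.
             (\<forall>i < n. mode n k A = (\<Sum>j = 0..<n. A $$ (i, j) * modal_cofactor n k A i j)) \<and>
             (\<forall>j < n. mode n k A = (\<Sum>i = 0..<n. A $$ (i, j) * modal_cofactor n k A i j))))
     \<and>
     (\<forall>A \<in> carrier_mat n n. \<forall>\<mu>.
        det (\<mu> \<cdot>\<^sub>m 1\<^sub>m n - A) =
          \<mu> ^ n + (\<Sum>r = 1..n. (-1) ^ r *
            (\<Sum>I \<in> {I. I \<subseteq> {0..<n} \<and> card I = r}. mode r 0 (submatrix A I I)) * \<mu> ^ (n - r)))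
     \<and>
     (2 \<le> n \<longrightarrow> (\<exists>B \<in> carrier_mat n n. \<exists>C \<in> carrier_mat n n.
        (\<forall>k. mode n k B = mode n k C) \<and> spectrum B \<noteq> spectrum C))"
proof -
  have n: "0 < n"
    using assms by simp
  have large: "2 \<le> n" if "k mod int n \<noteq> 0" for k
    using n that by (cases "n = 1") auto
  show ?thesis
    using mode_0_eq_det[OF n] row_multilinear_mode col_multilinear_mode
      not_alternating_mode[OF large] mode_reflect[OF n] parseval_determinant_vector[OF n]
      has_vector_derivative_mode[OF n] mode_row_expansion mode_column_expansion
      det_smult_one_minus_eq_sum_fundamental_modes modes_do_not_determine_spectrum
    by (intro conjI ballI allI impI) auto
qed

end
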